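(* Let $I$ be a nonempty set and let $(E_i,0_i,1_i,\oplus_i,\circ_i)$, $i\in I$, be sequential effect algebras. Then the product effect algebra $E=\prod_{i\in I}E_i$ admits a unique sequential product if and only if each effect algebra $E_i$, $i\in I$, admits a unique sequential product.
   Context: An effect algebra is a system $(E,0,1,\oplus)$ where $0\neq 1\in E$ and $\oplus$ is a partial binary operation on $E$ such that: (A1) if $a\oplus b$ is defined then $b\oplus a$ is defined and $b\oplus a=a\oplus b$; (A2) if $a\oplus b$ and $(a\oplus b)\oplus c$ are defined, then $b\oplus c$ and $a\oplus(b\oplus c)$ are defined and $a\oplus(b\oplus c)=(a\oplus b)\oplus c$; (A3) for every $a\in E$ there is a unique $a'\in E$ with $a\oplus a'=1$; (A4) if $a\oplus 1$ is defined then $a=0$. We write $a\perp b$ if $a\oplus b$ is defined. For a binary operation $\circ$ on $E$ write $a\mid b$ if $a\circ b=b\circ a$. A sequential product on an effect algebra $E$ is a binary operation $\circ\colon E\times E\to E$ such that: (S1) if $b\perp c$ then $a\circ b\perp a\circ c$ and $a\circ(b\oplus c)=a\circ b\oplus a\circ c$; (S2) $1\circ a=a$ for all $a$; (S3) if $a\circ b=0$ then $a\mid b$; (S4) if $a\mid b$ then $a\mid b'$ and $a\circ(b\circ c)=(a\circ b)\circ c$ for all $c$; (S5) if $c\mid a$ and $c\mid b$ then $c\mid a\circ b$ and, when $a\perp b$, $c\mid(a\oplus b)$. A sequential effect algebra (SEA) is an effect algebra together with a sequential product. The product effect algebra $\prod_{i\in I} E_i$ is the Cartesian product, with zero $(0_i)_{i\in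 I}$, unit $(1_i)_{i\in I}$, $(a_i)\perp(b_i)$ if and only if $a_i\perp b_i$ for every $i$, and in this case $(a_i)\oplus(b_i)=(a_i\oplus_i b_i)$. *)

theory Defs
  imports "HOL-Algebra.Congruence"
begin

text \<open>
  The partial operation is a map into \<open>option\<close>: \<open>osum E a b = Some c\<close> says that the sum
  of \<open>a\<close> and \<open>b\<close> is defined and equals \<open>c\<close>. Only its values on the carrier matter.
\<close>

record 'a ea = "'a partial_object" +
  ea_zero :: 'a
  ea_one :: 'a
  osum :: "'a \<Rightarrow> 'a \<Rightarrow> 'a option"

definition orth :: "('a, 'm) ea_scheme \<Rightarrow> 'a \<Rightarrow> 'a \<Rightarrow> bool" where
  "orth E a b \<longleftrightarrow> osum E a b \<noteq> None"

locale effect_algebra =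
  fixes E :: "('a, 'm) ea_scheme"
  assumes zero_closed: "ea_zero E \<in> carrier E"
    and one_closed: "ea_one E \<in> carrier E"
    and zero_neq_one: "ea_zero E \<noteq> ea_one E"
    and osum_closed:
      "\<lbrakk>a \<in> carrier E; b \<in> carrier E; osum E a b = Some c\<rbrakk> \<Longrightarrow> c \<in> carrier E"
    and A1:
      "\<lbrakk>a \<in> carrier E; b \<in> carrier E; osum E a b = Some c\<rbrakk> \<Longrightarrow> osum E b a = Some c"
    and A2:
      "\<lbrakk>a \<in> carrier E; b \<in> carrier E; c \<in> carrier E;
        osum E a b = Some d; osum E d c = Some e\<rbrakk>
       \<Longrightarrow> \<exists>f. osum E b c = Some f \<and> osum E a f = Some e"
    and A3: "a \<in> carrier E \<Longrightarrow> \<exists>!b. b \<in> carrier E \<and> osum E a b = Some (ea_one E)"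
    and A4: "\<lbrakk>a \<in> carrier E; orth E a (ea_one E)\<rbrakk> \<Longrightarrow> a = ea_zero E"

definition ocompl :: "('a, 'm) ea_scheme \<Rightarrow> 'a \<Rightarrow> 'a" where
  "ocompl E a = (THE b. b \<in> carrier E \<and> osum E a b = Some (ea_one E))"

definition seq_comm :: "('a \<Rightarrow> 'a \<Rightarrow> 'a) \<Rightarrow> 'a \<Rightarrow> 'a \<Rightarrow> bool" where
  "seq_comm p a b \<longleftrightarrow> p a b = p b a"

locale sequential_effect_algebra = effect_algebra E
  for E :: "('a, 'm) ea_scheme" +
  fixes p :: "'a \<Rightarrow> 'a \<Rightarrow> 'a"
  assumes seq_closed: "\<lbrakk>a \<in> carrier E; b \<in> carrier E\<rbrakk> \<Longrightarrow> p a b \<in> carrier E"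
    and S1:
      "\<lbrakk>a \<in> carrier E; b \<in> carrier E; c \<in> carrier E; osum E b c = Some d\<rbrakk>
       \<Longrightarrow> osum E (p a b) (p a c) = Some (p a d)"
    and S2: "a \<in> carrier E \<Longrightarrow> p (ea_one E) a = a"
    and S3: "\<lbrakk>a \<in> carrier E; b \<in> carrier E; p a b = ea_zero E\<rbrakk> \<Longrightarrow> seq_comm p a b"
    and S4_compl:
      "\<lbrakk>a \<in> carrier E; b \<in> carrier E; seq_comm p a b\<rbrakk> \<Longrightarrow> seq_comm p a (ocompl E b)"
    and S4_assoc:
      "\<lbrakk>a \<in> carrier E; b \<in> carrier E; c \<in> carrier E; seq_comm p a b\<rbrakk>
       \<Longrightarrow> p a (p b c) = p (p a b) c"
    and S5_seq:
      "\<lbrakk>a \<in> carrier E; b \<in> carrier E; c \<in> carrier E; seq_comm p c a; seq_comm p c b\<rbrakk>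
       \<Longrightarrow> seq_comm p c (p a b)"
    and S5_osum:
      "\<lbrakk>a \<in> carrier E; b \<in> carrier E; c \<in> carrier E; seq_comm p c a; seq_comm p c b;
        osum E a b = Some d\<rbrakk>
       \<Longrightarrow> seq_comm p c d"

text \<open>
  A sequential product is an operation on the carrier, so uniqueness is up to values
  outside the carrier.
\<close>

definition admits_unique_sequential_product :: "('a, 'm) ea_scheme \<Rightarrow> bool" where
  "admits_unique_sequential_product E \<longleftrightarrow>
     (\<exists>p. sequential_effect_algebra E p \<and>
        (\<forall>q. sequential_effect_algebra E q \<longrightarrow>
           (\<forall>a \<in> carrier E. \<forall>b \<in> carrier E. q a b = p a b)))"

definition product_ea :: "'i set \<Rightarrow> ('i \<Rightarrow> ('a, 'm) ea_scheme) \<Rightarrow> ('i \<Rightarrow> 'a) ea" where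
  "product_ea I E =
     \<lparr>carrier = (\<Pi>\<^sub>E i\<in>I. carrier (E i)),
      ea_zero = (\<lambda>i\<in>I. ea_zero (E i)),
      ea_one = (\<lambda>i\<in>I. ea_one (E i)),
      osum = (\<lambda>a b. if \<forall>i\<in>I. orth (E i) (a i) (b i)
                    then Some (\<lambda>i\<in>I. the (osum (E i) (a i) (b i)))
                    else None)\<rparr>"

end

theory Submission
  imports Defs
begin

text \<open>
  The nontrivial point is that every sequential product on \<open>\<Prod>E\<^sub>i\<close> is computed componentwise.
  Let \<open>e\<close> be the element that is one at \<open>j\<close> and zero elsewhere. A common lower bound of \<open>e\<close>
  and \<open>e'\<close> vanishes, so \<open>e \<circ> e' = 0\<close>; it follows that \<open>e\<close> commutes with every \<open>a\<close> and that
  \<open>e \<circ> a\<close> is the truncation of \<open>a\<close> to the coordinate \<open>j\<close>. By (S4),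
  \<open>e \<circ> (a \<circ> b) = (e \<circ> a) \<circ> b = a \<circ> (e \<circ> b)\<close>, so the \<open>j\<close>-th coordinate of \<open>a \<circ> b\<close>
  depends only on \<open>a\<^sub>j\<close> and \<open>b\<^sub>j\<close>, and this dependence is a sequential product on \<open>E\<^sub>j\<close>.
\<close>

section \<open>Effect algebras\<close>

context effect_algebra
begin

lemma ocompl_props:
  assumes "a \<in> carrier E"
  shows ocompl_closed: "ocompl E a \<in> carrier E"
    and osum_ocompl: "osum E a (ocompl E a) = Some (ea_one E)"
  using theI'[OF A3[OF assms]] unfolding ocompl_def by auto

lemma ocompl_unique:
  assumes "a \<in> carrier E" "b \<in> carrier E" "osum E a b = Some (ea_one E)"
  shows "ocompl E a = b"
  using A3[OF assms(1)] ocompl_props[OF assms(1)] assms by blast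

lemma osum_ocompl_left:
  "a \<in> carrier E \<Longrightarrow> osum E (ocompl E a) a = Some (ea_one E)"
  by (simp add: A1 ocompl_closed osum_ocompl)

lemma ocompl_ocompl: "a \<in> carrier E \<Longrightarrow> ocompl E (ocompl E a) = a"
  by (simp add: ocompl_closed ocompl_unique osum_ocompl_left)

lemma ocompl_one: "ocompl E (ea_one E) = ea_zero E"
  using A4[OF ocompl_closed[OF one_closed]] osum_ocompl_left[OF one_closed]
  by (simp add: orth_def)

lemma ocompl_zero: "ocompl E (ea_zero E) = ea_one E"
  using ocompl_ocompl[OF one_closed] by (simp add: ocompl_one)

text \<open>(A2) turns (a' \<oplus> a) \<oplus> 0 = 1 \<oplus> 0 = 1 into a' \<oplus> (a \<oplus> 0)
  = 1, so a \<oplus> 0 is the complement of a', which is a.\<close>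

lemma osum_zero_right:
  assumes "a \<in> carrier E"
  shows "osum E a (ea_zero E) = Some a"
proof -
  have "osum E (ea_one E) (ea_zero E) = Some (ea_one E)"
    using osum_ocompl[OF one_closed] by (simp add: ocompl_one)
  then obtain f where f: "osum E a (ea_zero E) = Some f" "osum E (ocompl E a) f = Some (ea_one E)"
    using A2[OF ocompl_closed[OF assms] assms zero_closed osum_ocompl_left[OF assms]] by blast
  have "f \<in> carrier E"
    using osum_closed[OF assms zero_closed f(1)] .
  then have "f = a"
    using ocompl_unique[OF ocompl_closed[OF assms] _ f(2)] ocompl_ocompl[OF assms] by simp
  with f show ?thesis by simp
qed

lemma osum_zero_left: "a \<in> carrier E \<Longrightarrow> osum E (ea_zero E) a = Some a"
  using A1 osum_zero_right zero_closed by blast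

text \<open>With f = a \<oplus> c', (A2) gives b \<oplus> f = 1 = d \<oplus> f, so b and d are both
  the complement of f.\<close>

lemma osum_left_cancel:
  assumes a: "a \<in> carrier E" and b: "b \<in> carrier E" and d: "d \<in> carrier E"
    and ab: "osum E a b = Some c" and ad: "osum E a d = Some c"
  shows "b = d"
proof -
  have c: "c \<in> carrier E" using osum_closed[OF a b ab] .
  obtain f where f: "osum E a (ocompl E c) = Some f" "osum E b f = Some (ea_one E)"
    using A2[OF b a ocompl_closed[OF c] A1[OF a b ab] osum_ocompl[OF c]] by blast
  have df: "osum E d f = Some (ea_one E)"
    using A2[OF d a ocompl_closed[OF c] A1[OF a d ad] osum_ocompl[OF c]] f(1) by auto
  have fc: "f \<in> carrier E"
    using osum_closed[OF a ocompl_closed[OF c] f(1)] .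
  show ?thesis
    using ocompl_unique[OF fc b A1[OF b fc f(2)]] ocompl_unique[OF fc d A1[OF d fc df]] by simp
qed

text \<open>Since (a \<oplus> b) \<oplus> 1 = 0 \<oplus> 1 is defined, (A2) makes b \<oplus> 1
  defined, and (A4) applies.\<close>

lemma osum_eq_zero:
  assumes a: "a \<in> carrier E" and b: "b \<in> carrier E" and ab: "osum E a b = Some (ea_zero E)"
  shows "a = ea_zero E" "b = ea_zero E"
proof -
  have "orth E b (ea_one E)"
    using A2[OF a b one_closed ab osum_zero_left[OF one_closed]] by (auto simp: orth_def)
  then show "b = ea_zero E" using A4[OF b] by blast
  then show "a = ea_zero E" using ab osum_zero_right[OF a] by simp
qed

end

section \<open>Sequential effect algebras\<close>

lemma seq_comm_sym: "seq_comm p a b \<Longrightarrow> seq_comm p b a"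
  by (simp add: seq_comm_def)

context sequential_effect_algebra
begin

text \<open>Applying (S1) to 0 \<oplus> 0 = 0 gives a \<circ> 0 \<oplus> a \<circ> 0 = a \<circ> 0 =
  a \<circ> 0 \<oplus> 0; cancel.\<close>

lemma seq_zero_right:
  assumes a: "a \<in> carrier E"
  shows "p a (ea_zero E) = ea_zero E"
  using osum_left_cancel[OF seq_closed seq_closed zero_closed S1 osum_zero_right]
    a zero_closed osum_zero_right[OF zero_closed] seq_closed by blast

text \<open>From a \<circ> 0 = 0, (S3) gives a | 0, and (S4) then gives a | 1; (S2) evaluates 1
  \<circ> a.\<close>

lemma seq_one_right:
  assumes a: "a \<in> carrier E"
  shows "p a (ea_one E) = a"
  using S4_compl[OF a zero_closed S3[OF a zero_closed seq_zero_right[OF a]]] S2[OF a]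
  by (simp add: ocompl_zero seq_comm_def)

lemma seq_zero_mono:
  assumes "a \<in> carrier E" "b \<in> carrier E" "c \<in> carrier E"
    and "osum E b c = Some d" "p a d = ea_zero E"
  shows "p a b = ea_zero E"
  using osum_eq_zero(1)[OF seq_closed seq_closed] S1 assms by metis

text \<open>The elements \<open>x'\<close> and \<open>y'\<close> only witness x \<le> e and y \<le>
  e'. By monotonicity e \<circ> y and e' \<circ> x vanish, so x commutes with e' and hence with e.
  Expanding x = x \<circ> (e \<oplus> e') gives x \<circ> e = x. Now (S1) computes e \<circ> (x
  \<oplus> y), and (S5) lets e commute with the sum.\<close>

lemma seq_ocompl_zero_split:
  assumes e: "e \<in> carrier E" and ee: "p e (ocompl E e) = ea_zero E"
    and x: "x \<in> carrier E" "x' \<in> carrier E" "osum E x x' = Some e"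
    and y: "y \<in> carrier E" "y' \<in> carrier E" "osum E y y' = Some (ocompl E e)"
    and a: "osum E x y = Some a"
  shows "p e a = x" "seq_comm p e a"
proof -
  have e': "ocompl E e \<in> carrier E" using ocompl_closed[OF e] .
  have ey: "p e y = ea_zero E"
    using seq_zero_mono[OF e y ee] .
  have "p (ocompl E e) e = ea_zero E"
    using S3[OF e e' ee] ee by (simp add: seq_comm_def)
  then have "p (ocompl E e) x = ea_zero E"
    using seq_zero_mono[OF e' x] by blast
  then have xe': "seq_comm p x (ocompl E e)" and xe'0: "p x (ocompl E e) = ea_zero E"
    using S3[OF e' x(1)] by (auto simp: seq_comm_def)
  have xe: "seq_comm p x e"
    using S4_compl[OF x(1) e' xe'] by (simp add: ocompl_ocompl e)
  have "osum E (p x e) (ea_zero E) = Some x"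
    using S1[OF x(1) e e' osum_ocompl[OF e]] xe'0 seq_one_right[OF x(1)] by simp
  then have "p x e = x"
    using osum_zero_right[OF seq_closed[OF x(1) e]] by simp
  then have ex: "p e x = x" using xe by (simp add: seq_comm_def)
  show "p e a = x"
    using S1[OF e x(1) y(1) a] ex ey osum_zero_right[OF x(1)] by simp
  show "seq_comm p e a"
    using S5_osum[OF x(1) y(1) e seq_comm_sym[OF xe] S3[OF e y(1) ey] a] .
qed

end

section \<open>Products\<close>

lemma product_ea_simps:
  "carrier (product_ea I E) = (\<Pi>\<^sub>E i\<in>I. carrier (E i))"
  "ea_zero (product_ea I E) = (\<lambda>i\<in>I. ea_zero (E i))"
  "ea_one (product_ea I E) = (\<lambda>i\<in>I. ea_one (E i))"
  by (simp_all add: product_ea_def)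

text \<open>Reduces sums in the product to coordinates; extensionality of \<open>c\<close> reflects
  that the sum is a function restricted to \<open>I\<close>.\<close>

lemma osum_product_ea_eq_Some_iff:
  "osum (product_ea I E) a b = Some c \<longleftrightarrow>
     c \<in> extensional I \<and> (\<forall>i\<in>I. osum (E i) (a i) (b i) = Some (c i))"
  by (auto simp: product_ea_def orth_def fun_eq_iff extensional_def) (metis option.sel)

text \<open>The sequential products of the factors stay outside the locale, so that one family can
  carry several of them. Nonemptiness of \<open>I\<close> separates zero from one in the
  product.\<close>

locale effect_algebra_family =
  fixes I :: "'i set" and E :: "'i \<Rightarrow> ('a, 'm) ea_scheme"
  assumes index_nonempty: "I \<noteq> {}"
    and component: "i \<in> I \<Longrightarrow> effect_algebra (E i)"
begin

abbreviation P :: "('i \<Rightarrow> 'a) ea" where "P \<equiv> product_ea I E"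

lemma product_ocompl_props:
  assumes a: "a \<in> carrier P"
  shows "(\<lambda>i\<in>I. ocompl (E i) (a i)) \<in> carrier P"
    and "osum P a (\<lambda>i\<in>I. ocompl (E i) (a i)) = Some (ea_one P)"
  using a effect_algebra.ocompl_props[OF component]
  by (auto simp: product_ea_simps osum_product_ea_eq_Some_iff PiE_iff)

text \<open>Stated for an arbitrary complement \<open>b\<close> and not for
  \<open>ocompl P a\<close>, because it serves to establish (A3) for the product.\<close>

lemma product_compl_unique:
  assumes a: "a \<in> carrier P" and b: "b \<in> carrier P" and ab: "osum P a b = Some (ea_one P)"
  shows "b = (\<lambda>i\<in>I. ocompl (E i) (a i))"
proof (rule extensionalityI[of _ I])
  show "b i = (\<lambda>i\<in>I. ocompl (E i) (a i)) i" if i: "i \<in> I" for i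
    using effect_algebra.ocompl_unique[OF component[OF i], of "a i" "b i"] a b ab i
    by (auto simp: product_ea_simps osum_product_ea_eq_Some_iff PiE_iff)
qed (use b in \<open>auto simp: product_ea_simps PiE_iff\<close>)

sublocale prod: effect_algebra P
proof
  show "ea_zero P \<in> carrier P" "ea_one P \<in> carrier P"
    using effect_algebra.zero_closed[OF component] effect_algebra.one_closed[OF component]
    by (auto simp: product_ea_simps)
  obtain i where i: "i \<in> I" using index_nonempty by blast
  then have "ea_zero P i \<noteq> ea_one P i"
    using effect_algebra.zero_neq_one[OF component] by (simp add: product_ea_simps)
  then show "ea_zero P \<noteq> ea_one P" by auto
next
  fix a b c assume *: "a \<in> carrier P" "b \<in> carrier P" "osum P a b = Some c"
  have "c i \<in> carrier (E i)" if "i \<in> I" for i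
    using effect_algebra.osum_closed[OF component, of i "a i" "b i" "c i"] * that
    by (simp add: product_ea_simps osum_product_ea_eq_Some_iff PiE_iff)
  with * show "c \<in> carrier P"
    by (simp add: product_ea_simps osum_product_ea_eq_Some_iff PiE_iff)
next
  fix a b c assume *: "a \<in> carrier P" "b \<in> carrier P" "osum P a b = Some c"
  have "osum (E i) (b i) (a i) = Some (c i)" if "i \<in> I" for i
    using effect_algebra.A1[OF component, of i "a i" "b i" "c i"] * that
    by (simp add: product_ea_simps osum_product_ea_eq_Some_iff PiE_iff)
  with * show "osum P b a = Some c"
    by (simp add: osum_product_ea_eq_Some_iff)
next
  fix a b c d e
  assume *: "a \<in> carrier P" "b \<in> carrier P" "c \<in> carrier P"
    "osum P a b = Some d" "osum P d c = Some e"
  have "\<exists>f. osum (E i) (b i) (c i) = Some f \<and> osum (E i) (a i) f = Some (e i)"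
    if "i \<in> I" for i
    using effect_algebra.A2[OF component, of i "a i" "b i" "c i" "d i" "e i"] * that
    by (simp add: product_ea_simps osum_product_ea_eq_Some_iff PiE_iff)
  \<comment> \<open>The sums of \<open>b i\<close> and \<open>c i\<close> are gathered into one
    function, whose restriction to \<open>I\<close> is the sum in the product.\<close>
  then obtain f where
    "\<forall>i\<in>I. osum (E i) (b i) (c i) = Some (f i) \<and> osum (E i) (a i) (f i) = Some (e i)"
    using bchoice[of I "\<lambda>i f. osum (E i) (b i) (c i) = Some f \<and> osum (E i) (a i) f = Some (e i)"]
    by blast
  then have "osum P b c = Some (restrict f I) \<and> osum P a (restrict f I) = Some e"
    using * by (auto simp: osum_product_ea_eq_Some_iff)
  then show "\<exists>f. osum P b c = Some f \<and> osum P a f = Some e" by blast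
next
  fix a assume "a \<in> carrier P"
  then show "\<exists>!b. b \<in> carrier P \<and> osum P a b = Some (ea_one P)"
    by (intro ex1I[of _ "\<lambda>i\<in>I. ocompl (E i) (a i)"])
      (simp_all add: product_ocompl_props product_compl_unique)
next
  fix a assume a: "a \<in> carrier P" and "orth P a (ea_one P)"
  then obtain c where c: "osum P a (ea_one P) = Some c" by (auto simp: orth_def)
  show "a = ea_zero P"
  proof (rule extensionalityI[of _ I])
    show "a i = ea_zero P i" if i: "i \<in> I" for i
      using effect_algebra.A4[OF component[OF i], of "a i"] a c i
      by (auto simp: product_ea_simps osum_product_ea_eq_Some_iff PiE_iff orth_def)
  qed (use a in \<open>auto simp: product_ea_simps PiE_iff\<close>)
qed

lemma product_ocompl:
  "a \<in> carrier P \<Longrightarrow> ocompl P a = (\<lambda>i\<in>I. ocompl (E i) (a i))"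
  by (intro product_compl_unique prod.ocompl_props)

section \<open>Componentwise sequential products\<close>

lemma sequential_effect_algebra_product:
  assumes p: "\<And>i. i \<in> I \<Longrightarrow> sequential_effect_algebra (E i) (p i)"
  shows "sequential_effect_algebra P (\<lambda>a b. \<lambda>i\<in>I. p i (a i) (b i))"
    (is "sequential_effect_algebra P ?p")
proof -
  \<comment> \<open>Commutation is a condition on each coordinate, so each of (S3) to (S5) reduces
    to the same axiom in the factors.\<close>
  have comm: "seq_comm ?p a b \<longleftrightarrow> (\<forall>i\<in>I. seq_comm (p i) (a i) (b i))" for a b
    by (auto simp: seq_comm_def fun_eq_iff restrict_def)
  note simps = product_ea_simps osum_product_ea_eq_Some_iff PiE_iff
  show ?thesis
  proof
    fix a b assume "a \<in> carrier P" "b \<in> carrier P"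
    then show "?p a b \<in> carrier P"
      using sequential_effect_algebra.seq_closed[OF p] by (simp add: simps)
  next
    fix a b c d
    assume "a \<in> carrier P" "b \<in> carrier P" "c \<in> carrier P" "osum P b c = Some d"
    then show "osum P (?p a b) (?p a c) = Some (?p a d)"
      by (simp add: simps sequential_effect_algebra.S1[OF p])
  next
    fix a assume "a \<in> carrier P"
    then show "?p (ea_one P) a = a"
      using sequential_effect_algebra.S2[OF p]
      by (auto simp: simps intro!: extensionalityI[of _ I])
  next
    fix a b assume *: "a \<in> carrier P" "b \<in> carrier P" "?p a b = ea_zero P"
    have "seq_comm (p i) (a i) (b i)" if "i \<in> I" for i
    proof -
      have "p i (a i) (b i) = ea_zero (E i)"
        using fun_cong[OF *(3), of i] that by (simp add: simps)
      then show ?thesis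
        using sequential_effect_algebra.S3[OF p, of i "a i" "b i"] *(1,2) that by (simp add: simps)
    qed
    then show "seq_comm ?p a b" by (simp add: comm)
  next
    fix a b assume *: "a \<in> carrier P" "b \<in> carrier P" "seq_comm ?p a b"
    have "seq_comm (p i) (a i) (ocompl (E i) (b i))" if "i \<in> I" for i
      using sequential_effect_algebra.S4_compl[OF p, of i "a i" "b i"] * that
      by (simp add: simps comm)
    with * show "seq_comm ?p a (ocompl P b)" by (simp add: comm product_ocompl)
  next
    fix a b c
    assume *: "a \<in> carrier P" "b \<in> carrier P" "c \<in> carrier P" "seq_comm ?p a b"
    have "p i (a i) (p i (b i) (c i)) = p i (p i (a i) (b i)) (c i)" if "i \<in> I" for i
      using sequential_effect_algebra.S4_assoc[OF p, of i "a i" "b i" "c i"] * that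
      by (simp add: simps comm)
    then show "?p a (?p b c) = ?p (?p a b) c" by (simp cong: restrict_cong)
  next
    fix a b c
    assume *: "a \<in> carrier P" "b \<in> carrier P" "c \<in> carrier P"
      "seq_comm ?p c a" "seq_comm ?p c b"
    have "seq_comm (p i) (c i) (p i (a i) (b i))" if "i \<in> I" for i
      using sequential_effect_algebra.S5_seq[OF p, of i "a i" "b i" "c i"] * that
      by (simp add: simps comm)
    then show "seq_comm ?p c (?p a b)" by (simp add: comm)
  next
    fix a b c d
    assume *: "a \<in> carrier P" "b \<in> carrier P" "c \<in> carrier P"
      "seq_comm ?p c a" "seq_comm ?p c b" "osum P a b = Some d"
    have "seq_comm (p i) (c i) (d i)" if "i \<in> I" for i
      using sequential_effect_algebra.S5_osum[OF p, of i "a i" "b i" "c i" "d i"] * that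
      by (simp add: simps comm)
    then show "seq_comm ?p c d" by (simp add: comm)
  qed
qed

section \<open>Embedding a factor into the product by padding with zeros\<close>

definition embed :: "'i \<Rightarrow> 'a \<Rightarrow> 'i \<Rightarrow> 'a" where
  "embed j x = (\<lambda>i\<in>I. if i = j then x else ea_zero (E i))"

lemma embed_same [simp]: "j \<in> I \<Longrightarrow> embed j x j = x"
  by (simp add: embed_def)

lemma embed_closed: "x \<in> carrier (E j) \<Longrightarrow> embed j x \<in> carrier P"
  using effect_algebra.zero_closed[OF component] by (auto simp: product_ea_simps embed_def)

lemma embed_zero: "embed j (ea_zero (E j)) = ea_zero P"
  by (auto simp: product_ea_simps embed_def)

lemma embed_osum:
  assumes "osum (E j) x y = Some z"
  shows "osum P (embed j x) (embed j y) = Some (embed j z)"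
  using assms effect_algebra.osum_zero_right[OF component] effect_algebra.zero_closed[OF component]
  by (auto simp: osum_product_ea_eq_Some_iff embed_def)

lemma product_component_closed: "a \<in> carrier P \<Longrightarrow> j \<in> I \<Longrightarrow> a j \<in> carrier (E j)"
  by (auto simp: product_ea_simps)

end

section \<open>Arbitrary sequential products on the product, seen at one coordinate\<close>

locale product_sequential_product =
  effect_algebra_family I E + seq: sequential_effect_algebra "product_ea I E" q
  for I :: "'i set" and E :: "'i \<Rightarrow> ('a, 'm) ea_scheme" and q +
  fixes j
  assumes j: "j \<in> I"
begin

interpretation Ej: effect_algebra "E j"
  using component[OF j] .

abbreviation e :: "'i \<Rightarrow> 'a" where "e \<equiv> embed j (ea_one (E j))"

lemma e_closed: "e \<in> carrier P"
  using embed_closed Ej.one_closed .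

lemma ocompl_e: "ocompl P e = (\<lambda>i\<in>I. if i = j then ea_zero (E i) else ea_one (E i))"
  using e_closed effect_algebra.ocompl_one[OF component] effect_algebra.ocompl_zero[OF component]
  by (auto simp: product_ocompl embed_def intro!: restrict_ext)

text \<open>At each coordinate one of \<open>e\<close> and its complement is zero, and a summand of
  zero is zero.\<close>

lemma lower_bound_e_ocompl:
  assumes x: "x \<in> carrier P" "y \<in> carrier P" "z \<in> carrier P"
    and xy: "osum P x y = Some e" and xz: "osum P x z = Some (ocompl P e)"
  shows "x = ea_zero P"
proof (rule extensionalityI[of _ I])
  show "x i = ea_zero P i" if i: "i \<in> I" for i
  proof -
    interpret Ei: effect_algebra "E i" using component[OF i] .
    have "osum (E i) (x i) (y i) = Some (e i)" "osum (E i) (x i) (z i) = Some (ocompl P e i)"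
      using xy xz i by (auto simp: osum_product_ea_eq_Some_iff)
    then have "osum (E i) (x i) (y i) = Some (ea_zero (E i)) \<or>
        osum (E i) (x i) (z i) = Some (ea_zero (E i))"
      using i by (cases "i = j") (simp_all add: ocompl_e, simp add: embed_def)
    then show ?thesis
      using Ei.osum_eq_zero(1) x i by (auto simp: product_ea_simps PiE_iff)
  qed
qed (use x in \<open>auto simp: product_ea_simps PiE_iff\<close>)

text \<open>As e | e, (S4) gives e | e'. Hence e \<circ> e' = e' \<circ> e is a summand both of e =
  e \<circ> (e' \<oplus> e) and of e' = e' \<circ> (e \<oplus> e'), that is, a common lower
  bound.\<close>

lemma e_ocompl: "q e (ocompl P e) = ea_zero P"
proof -
  let ?e' = "ocompl P e"
  note e' = prod.ocompl_closed[OF e_closed]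
  have "seq_comm q e ?e'"
    using seq.S4_compl[OF e_closed e_closed] by (simp add: seq_comm_def)
  then have comm: "q ?e' e = q e ?e'" by (simp add: seq_comm_def)
  have "osum P (q e ?e') (q e e) = Some e"
    using seq.S1[OF e_closed e' e_closed prod.osum_ocompl_left[OF e_closed]]
      seq.seq_one_right[OF e_closed] by simp
  moreover have "osum P (q e ?e') (q ?e' ?e') = Some ?e'"
    using seq.S1[OF e' e_closed e' prod.osum_ocompl[OF e_closed]]
      seq.seq_one_right[OF e'] comm by simp
  ultimately show ?thesis
    using lower_bound_e_ocompl seq.seq_closed e_closed e' by blast
qed

lemma e_central:
  assumes a: "a \<in> carrier P"
  shows e_seq: "q e a = embed j (a j)" and e_comm: "seq_comm q e a"
proof -
  \<comment> \<open>Split \<open>a\<close> into its truncation to \<open>j\<close>, which lies below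
    \<open>e\<close>, and the rest \<open>?y\<close>, which lies below the complement of
    \<open>e\<close> with remainder \<open>?y'\<close>.\<close>
  let ?y = "\<lambda>i\<in>I. if i = j then ea_zero (E i) else a i"
  let ?y' = "\<lambda>i\<in>I. if i = j then ea_zero (E i) else ocompl (E i) (a i)"
  have aj: "a i \<in> carrier (E i)" if "i \<in> I" for i
    using product_component_closed[OF a that] .
  have x: "embed j (a j) \<in> carrier P" "embed j (ocompl (E j) (a j)) \<in> carrier P"
    using aj j by (auto intro!: embed_closed Ej.ocompl_closed)
  have xe: "osum P (embed j (a j)) (embed j (ocompl (E j) (a j))) = Some e"
    using aj j by (auto intro!: embed_osum Ej.osum_ocompl)
  have y: "?y \<in> carrier P" "?y' \<in> carrier P"
    using aj effect_algebra.zero_closed[OF component] effect_algebra.ocompl_closed[OF component]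
    by (auto simp: product_ea_simps)
  have ye: "osum P ?y ?y' = Some (ocompl P e)"
    using aj effect_algebra.osum_ocompl[OF component] effect_algebra.osum_zero_right[OF component]
      effect_algebra.zero_closed[OF component]
    by (auto simp: ocompl_e osum_product_ea_eq_Some_iff)
  have "osum P (embed j (a j)) ?y = Some a"
    using a aj effect_algebra.osum_zero_right[OF component]
      effect_algebra.osum_zero_left[OF component]
    by (auto simp: osum_product_ea_eq_Some_iff embed_def product_ea_simps PiE_iff)
  from seq.seq_ocompl_zero_split[OF e_closed e_ocompl x xe y ye this]
  show "q e a = embed j (a j)" "seq_comm q e a" by auto
qed

lemma embed_component_seq:
  assumes a: "a \<in> carrier P" and b: "b \<in> carrier P"
  shows "embed j (q a b j) = q (embed j (a j)) (embed j (b j))"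
proof -
  note ab = seq.seq_closed[OF a b]
  have ea: "embed j (a j) \<in> carrier P" and eb: "embed j (b j) \<in> carrier P"
    using product_component_closed[OF a j] product_component_closed[OF b j]
    by (auto intro: embed_closed)
  \<comment> \<open>Truncating the left factor truncates the product: (e \<circ> c) \<circ> d = e
    \<circ> (c \<circ> d).\<close>
  have left: "q (embed j (c j)) d = embed j (q c d j)"
    if c: "c \<in> carrier P" and d: "d \<in> carrier P" for c d
    using seq.S4_assoc[OF e_closed c d e_comm[OF c]] e_seq[OF c] e_seq[OF seq.seq_closed[OF c d]]
    by simp
  \<comment> \<open>The right factor follows by moving \<open>e\<close> to the left: a \<circ> (e
    \<circ> b) = (a \<circ> e) \<circ> b = (e \<circ> a) \<circ> b.\<close>
  have "q a (embed j (b j)) = q (q a e) b"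
    using seq.S4_assoc[OF a e_closed b seq_comm_sym[OF e_comm[OF a]]] e_seq[OF b] by simp
  also have "\<dots> = embed j (q a b j)"
    using e_comm[OF a] e_seq[OF a] left[OF a b] by (simp add: seq_comm_def)
  finally show ?thesis
    using left[OF a eb] j by simp
qed

definition component_product :: "'a \<Rightarrow> 'a \<Rightarrow> 'a" where
  "component_product x y = q (embed j x) (embed j y) j"

lemma component_seq:
  "a \<in> carrier P \<Longrightarrow> b \<in> carrier P \<Longrightarrow> q a b j = component_product (a j) (b j)"
  using embed_component_seq[of a b] j by (metis component_product_def embed_same)

text \<open>The product of two embedded elements is again zero outside \<open>j\<close>, so
  \<open>embed j\<close> is multiplicative and axioms of \<open>q\<close> can be pulled back along
  it.\<close>

lemma embed_component_product:
  assumes "x \<in> carrier (E j)" "y \<in> carrier (E j)"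
  shows "embed j (component_product x y) = q (embed j x) (embed j y)"
  using embed_component_seq[OF embed_closed embed_closed] assms j by (simp add: component_product_def)

lemma seq_comm_embed_iff:
  assumes "x \<in> carrier (E j)" "y \<in> carrier (E j)"
  shows "seq_comm q (embed j x) (embed j y) \<longleftrightarrow> seq_comm component_product x y"
  using embed_component_product assms by (metis component_product_def seq_comm_def)

text \<open>Covers elements outside the image of \<open>embed j\<close> too, such as complements
  taken in the product.\<close>

lemma seq_comm_component:
  assumes "a \<in> carrier P" "b \<in> carrier P" "seq_comm q a b"
  shows "seq_comm component_product (a j) (b j)"
  using assms component_seq by (metis seq_comm_def)

lemma sequential_effect_algebra_component: "sequential_effect_algebra (E j) component_product"
proof
  fix x y assume x: "x \<in> carrier (E j)" and y: "y \<in> carrier (E j)"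
  note ex = embed_closed[OF x] and ey = embed_closed[OF y]
  show "component_product x y \<in> carrier (E j)"
    using product_component_closed[OF seq.seq_closed[OF ex ey] j] by (simp add: component_product_def)
  show "seq_comm component_product x y" if "component_product x y = ea_zero (E j)"
    using seq.S3[OF ex ey] embed_component_product[OF x y] that seq_comm_embed_iff[OF x y]
    by (simp add: embed_zero)
  \<comment> \<open>The complement of \<open>embed j y\<close> in the product is one, not zero, away
    from \<open>j\<close>; only its coordinate at \<open>j\<close> is used.\<close>
  show "seq_comm component_product x (ocompl (E j) y)" if "seq_comm component_product x y"
    using seq_comm_component[OF ex prod.ocompl_closed[OF ey] seq.S4_compl[OF ex ey]] that
      seq_comm_embed_iff[OF x y] j by (simp add: product_ocompl ey)
  fix z assume z: "z \<in> carrier (E j)"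
  note ez = embed_closed[OF z]
  show "component_product x (component_product y z) = component_product (component_product x y) z" if "seq_comm component_product x y"
    using seq.S4_assoc[OF ex ey ez] that seq_comm_embed_iff[OF x y]
      embed_component_product[OF x y] embed_component_product[OF y z] by (simp add: component_product_def)
  show "seq_comm component_product z (component_product x y)" if "seq_comm component_product z x" "seq_comm component_product z y"
    using seq_comm_component[OF ez seq.seq_closed[OF ex ey] seq.S5_seq[OF ex ey ez]] that
      seq_comm_embed_iff[OF z x] seq_comm_embed_iff[OF z y] j by (simp add: component_product_def)
  fix w
  show "osum (E j) (component_product x y) (component_product x z) = Some (component_product x w)" if "osum (E j) y z = Some w"
    using seq.S1[OF ex ey ez embed_osum[OF that]] j
    by (simp add: component_product_def osum_product_ea_eq_Some_iff)
  show "seq_comm component_product z w"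
    if "seq_comm component_product z x" "seq_comm component_product z y" "osum (E j) x y = Some w"
    using seq_comm_component[OF ez embed_closed seq.S5_osum[OF ex ey ez _ _ embed_osum[OF that(3)]]]
      that seq_comm_embed_iff[OF z x] seq_comm_embed_iff[OF z y] j Ej.osum_closed[OF x y that(3)]
    by simp
next
  fix x assume x: "x \<in> carrier (E j)"
  \<comment> \<open>The unit of \<open>E j\<close> embeds as \<open>e\<close>, so the action of
    \<open>e\<close> by truncation takes the place of (S2) for \<open>q\<close>.\<close>
  show "component_product (ea_one (E j)) x = x"
    using e_seq[OF embed_closed[OF x]] j by (simp add: component_product_def)
qed

end

section \<open>Uniqueness\<close>

theorem theorem4p6:
  fixes I :: "'i set"
    and E :: "'i \<Rightarrow> ('a, 'm) ea_scheme"
    and p :: "'i \<Rightarrow> 'a \<Rightarrow> 'a \<Rightarrow> 'a"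
  assumes "I \<noteq> {}"
    and "\<And>i. i \<in> I \<Longrightarrow> sequential_effect_algebra (E i) (p i)"
  shows "admits_unique_sequential_product (product_ea I E)
    \<longleftrightarrow> (\<forall>i \<in> I. admits_unique_sequential_product (E i))"
proof -
  interpret effect_algebra_family I E
    by (rule effect_algebra_family.intro)
      (use assms sequential_effect_algebra.axioms(1) in blast)+
  show ?thesis
  proof
    assume "admits_unique_sequential_product P"
    then have unique: "q a b = r a b"
      if "sequential_effect_algebra P q" "sequential_effect_algebra P r"
        "a \<in> carrier P" "b \<in> carrier P" for q r a b
      using that unfolding admits_unique_sequential_product_def by metis
    show "\<forall>i\<in>I. admits_unique_sequential_product (E i)"
      unfolding admits_unique_sequential_product_def
    proof (intro ballI exI conjI allI impI)
      fix j q x y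
      assume j: "j \<in> I" and q: "sequential_effect_algebra (E j) q"
        and x: "x \<in> carrier (E j)" and y: "y \<in> carrier (E j)"
      \<comment> \<open>Exchanging the product at \<open>j\<close> alone gives a second
        componentwise product on \<open>P\<close>. Both agree there, and embedded elements carry
        \<open>x\<close> and \<open>y\<close> to coordinate \<open>j\<close>.\<close>
      have "sequential_effect_algebra (E i) ((p(j := q)) i)" if "i \<in> I" for i
        using assms(2)[OF that] q by simp
      then have "(\<lambda>i\<in>I. (p(j := q)) i (embed j x i) (embed j y i)) =
          (\<lambda>i\<in>I. p i (embed j x i) (embed j y i))"
        by (intro unique[OF sequential_effect_algebra_product sequential_effect_algebra_product]
            assms(2) embed_closed x y)
      from fun_cong[OF this, of j] show "q x y = p j x y"
        using j by simp
    qed (rule assms(2))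
  next
    assume "\<forall>i\<in>I. admits_unique_sequential_product (E i)"
    then have unique: "r x y = p i x y"
      if "i \<in> I" "sequential_effect_algebra (E i) r" "x \<in> carrier (E i)" "y \<in> carrier (E i)"
      for i r x y
      using that assms(2)[of i] unfolding admits_unique_sequential_product_def by metis
    show "admits_unique_sequential_product P"
      unfolding admits_unique_sequential_product_def
    proof (intro exI conjI allI impI ballI)
      show "sequential_effect_algebra P (\<lambda>a b. \<lambda>i\<in>I. p i (a i) (b i))"
        by (rule sequential_effect_algebra_product) (rule assms(2))
      fix q a b
      assume q: "sequential_effect_algebra P q" and a: "a \<in> carrier P" and b: "b \<in> carrier P"
      have "q a b \<in> carrier P"
        using sequential_effect_algebra.seq_closed[OF q a b] .
      \<comment> \<open>At \<open>i\<close>, \<open>q\<close> acts through an operation on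
        \<open>E i\<close> that is itself a sequential product, hence equals \<open>p i\<close> on
        the carrier.\<close>
      moreover have "q a b i = p i (a i) (b i)" if i: "i \<in> I" for i
      proof -
        interpret Q: sequential_effect_algebra P q using q .
        interpret product_sequential_product I E q i
          by unfold_locales (rule i)
        show ?thesis
          using component_seq[OF a b] unique[OF i sequential_effect_algebra_component]
            product_component_closed a b i by simp
      qed
      ultimately show "q a b = (\<lambda>i\<in>I. p i (a i) (b i))"
        by (intro extensionalityI[of _ I]) (auto simp: product_ea_simps PiE_iff)
    qed
  qed
qed

end
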